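(* Let $E$ be a real vector space, let $f\colon E\to\mathbb{R}$ be convex, let $C$ be a nonempty convex subset of a real vector space, let $j\colon C\to E$ be affine, and let $k\colon C\to\mathbb{R}$ be convex. Then there exists an affine map $A\colon E\to\mathbb{R}$ such that $A\le f$ on $E$ and $$\inf_C\big[A\circ j+k\big]=\inf_C\big[f\circ j+k\big].$$
   Context: All vector spaces are real. "Convex" and "affine" have their usual senses: an affine map $A\colon E\to\mathbb{R}$ is a linear functional plus a real constant, and a map $j\colon C\to E$ on a convex set $C$ is affine if $j((1-t)c+td)=(1-t)j(c)+tj(d)$ for all $c,d\in C$ and $t\in[0,1]$. $A\le f$ on $E$ means $A(x)\le f(x)$ for all $x\in E$. Infima are taken in $[-\infty,\infty[$, i.e. the value $-\infty$ is allowed, and $\inf_C g$ denotes $\inf_{c\in C}g(c)$. *)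

theory Defs
  imports "HOL-Analysis.Analysis"
begin

definition affine_on :: "'b::real_vector set \<Rightarrow> ('b \<Rightarrow> 'a::real_vector) \<Rightarrow> bool" where
  "affine_on C j \<longleftrightarrow>
    (\<forall>c\<in>C. \<forall>d\<in>C. \<forall>t\<in>{0..1::real}.
      j ((1 - t) *\<^sub>R c + t *\<^sub>R d) = (1 - t) *\<^sub>R j c + t *\<^sub>R j d)"

definition affine_functional :: "('a::real_vector \<Rightarrow> real) \<Rightarrow> bool" where
  "affine_functional A \<longleftrightarrow> (\<exists>L b. linear L \<and> (\<forall>x. A x = L x + b))"

end

theory Submission
  imports Defs
begin

text \<open>
  Only the case of a finite infimum \<open>m\<close> has content. There \<open>m \<le> f (j c) + k c\<close> for all \<open>c \<in> C\<close>,
  and an affine \<open>A \<le> f\<close> with the same property is wanted; the infimum of \<open>A \<circ> j + k\<close> is then at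
  least \<open>m\<close>, and at most \<open>m\<close> because \<open>A \<le> f\<close>. If the infimum is \<open>- \<infinity>\<close>, any affine minorant
  of \<open>f\<close> will do, and its existence is the same problem for a one-point set.

  Write \<open>A x = L x + b\<close> with \<open>L\<close> linear. The two requirements say that the constant \<open>b\<close> lies above
  \<open>m - k c - L (j c)\<close> for all \<open>c\<close> and below \<open>f x - L x\<close> for all \<open>x\<close>. Such a \<open>b\<close> exists iff every
  lower value is at most every upper value, which with \<open>z = x - j c\<close> reads
  \<open>L z \<le> f (z + j c) + k c - m\<close>. So \<open>L\<close> has to be a linear minorant of
  \<open>h z = (INF c\<in>C. f (z + j c) + k c - m)\<close>. This \<open>h\<close> is convex, as the partial infimum of a
  function that is convex in \<open>(c, z)\<close> jointly, and \<open>0 \<le> h 0\<close> is exactly the choice of \<open>m\<close>. This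
  reduction is \<open>affine_minorant_above_on\<close>.

  What remains is a form of the Hahn-Banach theorem (\<open>convex_linear_minorant\<close>): a convex function on
  the whole space that is nonnegative at 0 has a linear minorant. Instead of extending functionals
  from subspaces, one shrinks the function: by Zorn's lemma there is a minimal convex function
  below it that vanishes at 0 (\<open>minimal_convex_minorant\<close>), and minimality forces linearity, because any
  failure of linearity would allow a smaller such function (\<open>minimal_convex_imp_linear\<close>).

  The partial infimum above, the lower bounds of chains for Zorn's lemma, and the smaller function
  that forces oddness are all pointwise infima of families; \<open>convex_on_INF_mix\<close> shows that
  all three are convex.
\<close>

text \<open>
  An infimum of convex functions need not be convex. The hypothesis \<open>mix\<close> is a common weakening of two
  situations in which it is: \<open>I\<close> is convex and \<open>F\<close> is jointly convex (take the corresponding convex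
  combination of \<open>i\<close> and \<open>i'\<close> as \<open>l\<close>), or the \<open>F i\<close> are convex and any two have a member of the family below
  both.
\<close>

lemma convex_on_INF_mix:
  fixes F :: "'i \<Rightarrow> 'a::real_vector \<Rightarrow> real"
  assumes ne: "I \<noteq> {}"
    and bdd: "\<And>x. bdd_below ((\<lambda>i. F i x) ` I)"
    and mix: "\<And>i i' x y t. i \<in> I \<Longrightarrow> i' \<in> I \<Longrightarrow> 0 < t \<Longrightarrow> t < 1 \<Longrightarrow>
      \<exists>l\<in>I. F l ((1 - t) *\<^sub>R x + t *\<^sub>R y) \<le> (1 - t) * F i x + t * F i' y"
  shows "convex_on UNIV (\<lambda>x. INF i\<in>I. F i x)"
proof (rule convex_onI)
  fix t :: real and x y :: 'a
  assume t: "0 < t" "t < 1"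
  let ?z = "(1 - t) *\<^sub>R x + t *\<^sub>R y"
  have *: "(INF i\<in>I. F i ?z) \<le> (1 - t) * F i x + t * F i' y" if "i \<in> I" "i' \<in> I" for i i'
    using mix[OF that t, of x y] cINF_lower[OF bdd[of ?z]] by fastforce
  have "((INF i\<in>I. F i ?z) - (1 - t) * F i x) / t \<le> F i' y" if "i \<in> I" "i' \<in> I" for i i'
    using *[OF that] t by (simp add: field_simps)
  then have "((INF i\<in>I. F i ?z) - (1 - t) * F i x) / t \<le> (INF i'\<in>I. F i' y)" if "i \<in> I" for i
    using that by (intro cINF_greatest[OF ne]) auto
  then have "((INF i\<in>I. F i ?z) - t * (INF i'\<in>I. F i' y)) / (1 - t) \<le> F i x" if "i \<in> I" for i
    using that t by (simp add: field_simps)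
  then have "((INF i\<in>I. F i ?z) - t * (INF i'\<in>I. F i' y)) / (1 - t) \<le> (INF i\<in>I. F i x)"
    by (intro cINF_greatest[OF ne]) auto
  then show "(INF i\<in>I. F i ?z) \<le> (1 - t) * (INF i\<in>I. F i x) + t * (INF i\<in>I. F i y)"
    using t by (simp add: field_simps)
qed simp

text \<open>
  The origin is the midpoint of \<open>x\<close> and \<open>- x\<close>. Upper bounds of \<open>g\<close> at \<open>- x\<close> therefore give lower
  bounds at \<open>x\<close>, which keeps the infimum of a chain finite.
\<close>

lemma convex_on_vanishing_lower_bound:
  fixes g :: "'a::real_vector \<Rightarrow> real"
  assumes "convex_on UNIV g" "g 0 = 0"
  shows "- g (- x) \<le> g x"
  using convex_onD[OF assms(1), of "1/2" x "- x"] assms(2) by simp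

lemma minimal_convex_minorant:
  fixes h :: "'a::real_vector \<Rightarrow> real"
  assumes h: "convex_on UNIV h" "h 0 = 0"
  obtains g where "convex_on UNIV g" "g 0 = 0" "g \<le> h"
    "\<And>g'. convex_on UNIV g' \<Longrightarrow> g' 0 = 0 \<Longrightarrow> g' \<le> g \<Longrightarrow> g' = g"
proof -
  define M where "M = {g. convex_on UNIV g \<and> g 0 = 0 \<and> g \<le> h}"
  have "\<exists>m\<in>M. \<forall>a\<in>M. m \<ge> a \<longrightarrow> a = m"
  proof (rule predicate_Zorn)
    show "partial_order_on M (relation_of (\<ge>) M)"
      by (rule partial_order_on_relation_ofI) auto
  next
    fix K assume K: "K \<in> Chains (relation_of (\<ge>) M)"
    then have KM: "K \<subseteq> M" and tot: "\<And>g g'. g \<in> K \<Longrightarrow> g' \<in> K \<Longrightarrow> g \<le> g' \<or> g' \<le> g"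
      by (auto simp: Chains_def relation_of_def)
    show "\<exists>u\<in>M. \<forall>a\<in>K. a \<ge> u"
    proof (cases "K = {}")
      case True
      with h show ?thesis by (auto simp: M_def)
    next
      case False
      let ?u = "\<lambda>x. INF g\<in>K. g x"
      have bdd: "bdd_below ((\<lambda>g. g x) ` K)" for x
      proof (rule bdd_belowI2)
        fix g assume "g \<in> K"
        then have "convex_on UNIV g" "g 0 = 0" "g (- x) \<le> h (- x)"
          using KM by (auto simp: M_def le_fun_def)
        then show "- h (- x) \<le> g x"
          using convex_on_vanishing_lower_bound[of g x] by linarith
      qed
      have lower: "?u \<le> g" if "g \<in> K" for g
        using cINF_lower[OF bdd that] by (simp add: le_fun_def)
      have "convex_on UNIV ?u"
      proof (rule convex_on_INF_mix[OF False bdd])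
        fix g g' :: "'a \<Rightarrow> real" and x y and t :: real
        assume g: "g \<in> K" "g' \<in> K" and t: "0 < t" "t < 1"
        then obtain l where l: "l \<in> K" "l \<le> g" "l \<le> g'" using tot by blast
        then have "convex_on UNIV l" using KM by (auto simp: M_def)
        then have "l ((1 - t) *\<^sub>R x + t *\<^sub>R y) \<le> (1 - t) * l x + t * l y"
          using t by (intro convex_onD) auto
        also have "\<dots> \<le> (1 - t) * g x + t * g' y"
          using l t by (intro add_mono mult_left_mono) (auto simp: le_fun_def)
        finally show "\<exists>l\<in>K. l ((1 - t) *\<^sub>R x + t *\<^sub>R y) \<le> (1 - t) * g x + t * g' y"
          using l by blast
      qed
      moreover have "?u 0 = 0"
      proof -
        have "(\<lambda>g. g 0) ` K = {0}" using KM False by (auto simp: M_def)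
        then show ?thesis by simp
      qed
      moreover have "?u \<le> h"
        using False KM lower by (auto simp: M_def intro: order_trans)
      ultimately show ?thesis using lower by (auto simp: M_def)
    qed
  qed
  then obtain m where m: "m \<in> M" and min: "\<And>a. a \<in> M \<Longrightarrow> a \<le> m \<Longrightarrow> a = m" by blast
  show thesis
  proof (rule that[of m])
    fix g' assume "convex_on UNIV g'" "g' 0 = 0" "g' \<le> m"
    then show "g' = m" using m min[of g'] by (auto simp: M_def intro: order_trans)
  qed (use m in \<open>auto simp: M_def\<close>)
qed

text \<open>
  Each part of linearity comes from a convex function that vanishes at 0 and lies below \<open>g\<close>, hence
  equals \<open>g\<close>. For \<open>0 < s \<le> 1\<close>, convexity along the segment from 0 to \<open>x\<close> puts \<open>g (s x) / s\<close> below
  \<open>g x\<close>; so \<open>g\<close> is positively homogeneous, and thus subadditive. For oddness, one decreases \<open>g\<close> in the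
  direction \<open>y\<close>: the function \<open>x \<mapsto> (INF t\<ge>0. g (x + t y) - t g y)\<close> is at most \<open>- g y\<close> at \<open>- y\<close>, by
  \<open>t = 1\<close>. An odd sublinear function is linear.
\<close>

lemma minimal_convex_imp_linear:
  fixes g :: "'a::real_vector \<Rightarrow> real"
  assumes conv: "convex_on UNIV g" and zero: "g 0 = 0"
    and min: "\<And>g'. convex_on UNIV g' \<Longrightarrow> g' 0 = 0 \<Longrightarrow> g' \<le> g \<Longrightarrow> g' = g"
  shows "linear g"
proof -
  have contract: "g (s *\<^sub>R x) = s * g x" if s: "0 < s" "s \<le> 1" for s x
  proof -
    have "(\<lambda>x. g (s *\<^sub>R x) / s) = g"
    proof (rule min)
      show "convex_on UNIV (\<lambda>x. g (s *\<^sub>R x) / s)"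
      proof (rule convex_onI)
        fix t :: real and x y :: 'a
        assume "0 < t" "t < 1"
        then show "g (s *\<^sub>R ((1 - t) *\<^sub>R x + t *\<^sub>R y)) / s
            \<le> (1 - t) * (g (s *\<^sub>R x) / s) + t * (g (s *\<^sub>R y) / s)"
          using convex_onD[OF conv, of t "s *\<^sub>R x" "s *\<^sub>R y"] s
          by (simp add: field_simps scaleR_add_right)
      qed simp
      show "(\<lambda>x. g (s *\<^sub>R x) / s) \<le> g"
        using convex_onD[OF conv, of s 0] s zero
        by (auto simp: le_fun_def field_simps)
    qed (simp add: zero)
    then show ?thesis using s by (auto simp: fun_eq_iff field_simps)
  qed
  have homog: "g (s *\<^sub>R x) = s * g x" if s: "0 \<le> s" for s x
  proof (cases "s \<le> 1")
    case True
    then show ?thesis using contract[of s x] s zero by (cases "s = 0") auto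
  next
    case False
    then show ?thesis using contract[of "1 / s" "s *\<^sub>R x"] by (simp add: field_simps)
  qed
  have subadd: "g (x + y) \<le> g x + g y" for x y
    using convex_onD[OF conv, of "1/2" x y] homog[of "1/2" "x + y"]
    by (simp add: scaleR_add_right)
  have odd: "g (- y) = - g y" for y
  proof -
    let ?F = "\<lambda>t x. g (x + t *\<^sub>R y) - t * g y"
    let ?T = "\<lambda>x. INF t\<in>{0..}. ?F t x"
    have bdd: "bdd_below ((\<lambda>t. ?F t x) ` {0..})" for x
    proof (rule bdd_belowI2)
      fix t :: real assume "t \<in> {0..}"
      then show "- g (- x) \<le> ?F t x"
        using subadd[of "x + t *\<^sub>R y" "- x"] homog[of t y] by simp
    qed
    have "?T = g"
    proof (rule min)
      show "convex_on UNIV ?T"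
      proof (rule convex_on_INF_mix[OF _ bdd])
        fix a b t :: real and u v :: 'a
        assume a: "a \<in> {0..}" "b \<in> {0..}" and t: "0 < t" "t < 1"
        let ?l = "(1 - t) * a + t * b"
        have "(1 - t) *\<^sub>R u + t *\<^sub>R v + ?l *\<^sub>R y =
            (1 - t) *\<^sub>R (u + a *\<^sub>R y) + t *\<^sub>R (v + b *\<^sub>R y)"
          by (simp add: algebra_simps)
        then have "?F ?l ((1 - t) *\<^sub>R u + t *\<^sub>R v) \<le> (1 - t) * ?F a u + t * ?F b v"
          using convex_onD[OF conv, of t "u + a *\<^sub>R y" "v + b *\<^sub>R y"] t
          by (simp add: algebra_simps)
        moreover have "?l \<in> {0..}" using a t by simp
        ultimately show "\<exists>l\<in>{0..}. ?F l ((1 - t) *\<^sub>R u + t *\<^sub>R v) \<le> (1 - t) * ?F a u + t * ?F b v"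
          by blast
      qed simp
      have "(\<lambda>t. ?F t 0) ` {0..} = {0}" using homog by force
      then show "?T 0 = 0" by simp
      show "?T \<le> g"
        using cINF_lower[OF bdd, of 0] by (simp add: le_fun_def)
    qed
    then have "g (- y) = ?T (- y)" by (rule fun_cong[symmetric])
    also have "\<dots> \<le> ?F 1 (- y)" by (rule cINF_lower[OF bdd]) simp
    also have "\<dots> = - g y" using zero by simp
    finally have "g (- y) \<le> - g y" .
    then show ?thesis using convex_on_vanishing_lower_bound[OF conv zero, of "- y"] by simp
  qed
  show ?thesis
  proof (rule linearI)
    show "g (x + y) = g x + g y" for x y
      using subadd[of x y] subadd[of "x + y" "- y"] odd[of y] by simp
    show "g (r *\<^sub>R x) = r *\<^sub>R g x" for r x
      using homog[of r x] homog[of "- r" x] odd[of "r *\<^sub>R x"] by (cases "0 \<le> r") auto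
  qed
qed

lemma convex_linear_minorant:
  fixes h :: "'a::real_vector \<Rightarrow> real"
  assumes "convex_on UNIV h" "0 \<le> h 0"
  obtains L where "linear L" "\<And>x. L x \<le> h x"
proof -
  \<comment> \<open>Subtracting \<open>h 0 \<ge> 0\<close> normalises the value at 0 and only lowers \<open>h\<close>.\<close>
  have "convex_on UNIV (\<lambda>x. h x + - h 0)"
    using assms(1) by (intro convex_on_add) (auto simp: convex_on_const)
  then obtain g where "convex_on UNIV g" "g 0 = 0" and le: "g \<le> (\<lambda>x. h x + - h 0)"
    and "\<And>g'. convex_on UNIV g' \<Longrightarrow> g' 0 = 0 \<Longrightarrow> g' \<le> g \<Longrightarrow> g' = g"
    by (rule minimal_convex_minorant) auto
  then have "linear g" by (intro minimal_convex_imp_linear)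
  moreover have "g x \<le> h x" for x using le_funD[OF le, of x] assms(2) by simp
  ultimately show thesis by (rule that)
qed

text \<open>
  The slope of \<open>A\<close> is a linear minorant of the partial infimum \<open>h\<close> described at the start. Its constant
  is the smallest that the constraint on \<open>C\<close> permits, and \<open>L \<le> h\<close> says that this is small enough
  for \<open>A \<le> f\<close>.
\<close>

lemma affine_minorant_above_on:
  fixes f :: "'a::real_vector \<Rightarrow> real" and C :: "'b::real_vector set"
  assumes f: "convex_on UNIV f" and ne: "C \<noteq> {}" and C: "convex C"
    and j: "affine_on C j" and k: "convex_on C k"
    and m: "\<And>c. c \<in> C \<Longrightarrow> m \<le> f (j c) + k c"
  obtains A where "affine_functional A" "\<And>x. A x \<le> f x" "\<And>c. c \<in> C \<Longrightarrow> m \<le> A (j c) + k c"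
proof -
  let ?F = "\<lambda>c z. f (z + j c) + k c - m"
  let ?h = "\<lambda>z. INF c\<in>C. ?F c z"
  have mix: "\<exists>e\<in>C. ?F e ((1 - t) *\<^sub>R x + t *\<^sub>R y) \<le> (1 - t) * ?F c x + t * ?F d y"
    if cd: "c \<in> C" "d \<in> C" and t: "0 < t" "t < 1" for c d x y t
  proof
    let ?e = "(1 - t) *\<^sub>R c + t *\<^sub>R d"
    show "?e \<in> C" using C cd t by (intro convexD) auto
    have je: "j ?e = (1 - t) *\<^sub>R j c + t *\<^sub>R j d"
      using j cd t by (simp add: affine_on_def)
    have "(1 - t) *\<^sub>R x + t *\<^sub>R y + j ?e = (1 - t) *\<^sub>R (x + j c) + t *\<^sub>R (y + j d)"
      unfolding je by (simp add: algebra_simps)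
    then have "f ((1 - t) *\<^sub>R x + t *\<^sub>R y + j ?e) \<le> (1 - t) * f (x + j c) + t * f (y + j d)"
      using convex_onD[OF f, of t "x + j c" "y + j d"] t by simp
    moreover have "k ?e \<le> (1 - t) * k c + t * k d"
      using convex_onD[OF k, of t c d] cd t by simp
    ultimately show "?F ?e ((1 - t) *\<^sub>R x + t *\<^sub>R y) \<le> (1 - t) * ?F c x + t * ?F d y"
      by (simp add: algebra_simps)
  qed
  obtain d where d: "d \<in> C" using ne by blast
  have bdd: "bdd_below ((\<lambda>c. ?F c z) ` C)" for z
  proof (rule bdd_belowI2)
    fix c assume "c \<in> C"
    \<comment> \<open>At the midpoint 0 of \<open>z\<close> and \<open>- z\<close> the choice of \<open>m\<close> makes the whole family nonnegative.\<close>
    then obtain e where "e \<in> C" "?F e ((1 - 1/2) *\<^sub>R z + (1/2) *\<^sub>R (- z)) \<le> (1 - 1/2) * ?F c z + 1/2 * ?F d (- z)"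
      using mix[of c d "1/2" z "- z"] d by auto
    then show "- ?F d (- z) \<le> ?F c z" using m[of e] by (simp add: field_simps)
  qed
  have "convex_on UNIV ?h" using ne bdd mix by (rule convex_on_INF_mix)
  moreover have "0 \<le> ?h 0" using m by (intro cINF_greatest[OF ne]) simp
  ultimately obtain L where L: "linear L" and Lh: "\<And>z. L z \<le> ?h z"
    by (rule convex_linear_minorant) auto
  have sep: "m - k c - L (j c) \<le> f x - L x" if "c \<in> C" for c x
  proof -
    have "L (x - j c) \<le> ?F c (x - j c)"
      using Lh[of "x - j c"] cINF_lower[OF bdd that, of "x - j c"] by linarith
    then show ?thesis by (simp add: linear_diff[OF L])
  qed
  define b where "b = (SUP c\<in>C. m - k c - L (j c))"
  show thesis
  proof (rule that[of "\<lambda>x. L x + b"])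
    show "affine_functional (\<lambda>x. L x + b)" using L by (auto simp: affine_functional_def)
    have "b \<le> f x - L x" for x
      unfolding b_def using sep by (intro cSUP_least[OF ne])
    then show "L x + b \<le> f x" for x by (simp add: algebra_simps)
    have "m - k c - L (j c) \<le> b" if "c \<in> C" for c
      unfolding b_def using sep by (intro cSUP_upper[OF that] bdd_aboveI2)
    then show "m \<le> L (j c) + b + k c" if "c \<in> C" for c
      using that by force
  qed
qed

theorem corollary6p2:
  fixes f :: "'a::real_vector \<Rightarrow> real"
    and C :: "'b::real_vector set"
    and j :: "'b \<Rightarrow> 'a"
    and k :: "'b \<Rightarrow> real"
  assumes "convex_on UNIV f"
    and "C \<noteq> {}"
    and "convex C"
    and "affine_on C j"
    and "convex_on C k"
  shows "\<exists>A :: 'a \<Rightarrow> real. affine_functional A \<and> (\<forall>x. A x \<le> f x) \<and>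
    (INF c\<in>C. ereal (A (j c) + k c)) = (INF c\<in>C. ereal (f (j c) + k c))"
proof -
  let ?I = "INF c\<in>C. ereal (f (j c) + k c)"
  have mono: "(INF c\<in>C. ereal (A (j c) + k c)) \<le> ?I" if "\<And>x. A x \<le> f x" for A
    using that by (intro INF_mono) force
  show ?thesis
  proof (cases "?I = -\<infinity>")
    case True
    \<comment> \<open>On the one-point set \<open>{0}\<close> with \<open>m = f 0\<close>, \<open>A\<close> is a supporting functional of \<open>f\<close> at 0.\<close>
    obtain A where A: "affine_functional A" "\<And>x. A x \<le> f x"
      by (rule affine_minorant_above_on[OF assms(1), of "{0}" id "\<lambda>_. 0" "f 0"])
        (auto simp: affine_on_def convex_on_const)
    then show ?thesis using mono[of A] True by auto
  next
    case False
    obtain c0 where "c0 \<in> C" using assms(2) by blast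
    then have "?I \<le> ereal (f (j c0) + k c0)" by (rule INF_lower)
    with False obtain m where m: "?I = ereal m" by (cases ?I) auto
    have "m \<le> f (j c) + k c" if "c \<in> C" for c
      using INF_lower[OF that, of "\<lambda>c. ereal (f (j c) + k c)"] by (simp add: m)
    then obtain A where A: "affine_functional A" "\<And>x. A x \<le> f x"
      "\<And>c. c \<in> C \<Longrightarrow> m \<le> A (j c) + k c"
      using affine_minorant_above_on[OF assms] by blast
    then have "?I \<le> (INF c\<in>C. ereal (A (j c) + k c))"
      unfolding m by (intro INF_greatest) auto
    then show ?thesis using A mono[of A] by (auto intro: antisym)
  qed
qed

end
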